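(* Let $r(t)$ be a real-valued continuous function on $[t_0,+\infty)$. If all solutions of the equation $\phi''+r(t)\phi=0$, $t\ge t_0$, vanish at $+\infty$ (i.e. $\phi(t)\to0$ as $t\to+\infty$ for every solution $\phi$), then the derivative of every nontrivial solution of the equation is unbounded on $[t_0,+\infty)$.
   Context: All solutions are real-valued. *)

theory Defs
  imports "HOL-Analysis.Analysis"
begin

text \<open>
  Derivatives are taken within the half-line, i.e. one-sided at \<open>t0\<close>, so the
  values of the functions to the left of \<open>t0\<close> are irrelevant; within the half-line they are
  uniquely determined.
\<close>

definition has_deriv_from :: "real \<Rightarrow> (real \<Rightarrow> real) \<Rightarrow> (real \<Rightarrow> real) \<Rightarrow> bool" where
  "has_deriv_from t0 f f' \<longleftrightarrow> (\<forall>t\<ge>t0. (f has_real_derivative f' t) (at t within {t0..}))"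

definition is_solution :: "real \<Rightarrow> (real \<Rightarrow> real) \<Rightarrow> (real \<Rightarrow> real) \<Rightarrow> bool" where
  "is_solution t0 r \<phi> \<longleftrightarrow>
     (\<exists>\<phi>' \<phi>''. has_deriv_from t0 \<phi> \<phi>' \<and> has_deriv_from t0 \<phi>' \<phi>'' \<and>
       (\<forall>t\<ge>t0. \<phi>'' t + r t * \<phi> t = 0))"

end

theory Submission
  imports Defs
begin

text \<open>
  Suppose that a nontrivial solution \<open>\<phi>\<close> has a bounded derivative, and let \<open>\<psi>\<close> be a second solution
  with Wronskian \<open>\<phi> * \<psi>' - \<phi>' * \<psi> = 1\<close>. As \<open>\<psi> \<longlongrightarrow> 0\<close> and \<open>\<phi>'\<close> is bounded, \<open>\<phi> * \<psi>' \<longlongrightarrow> 1\<close>; as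
  \<open>\<phi> \<longlongrightarrow> 0\<close>, this makes \<open>\<bar>\<psi>'\<bar>\<close> larger than \<open>1\<close> from some time on. By the mean value theorem
  \<open>\<psi> (T + 1) - \<psi> T\<close> then stays away from \<open>0\<close>, against \<open>\<psi> \<longlongrightarrow> 0\<close>.

  The solution \<open>\<psi>\<close> is obtained without a general existence theorem
  (\<open>second_solution\<close>). The Wronskian condition alone says that
  \<open>(\<psi>, \<psi>') = a (\<phi>, \<phi>') + (-\<phi>', \<phi>) / N\<close> where \<open>N = \<phi>\<^sup>2 + \<phi>'\<^sup>2\<close> and \<open>a\<close> is a scalar function. Inserting
  this into the equation leaves \<open>a' = (1 - r) (\<phi>\<^sup>2 - \<phi>'\<^sup>2) / N\<^sup>2\<close>, whose right-hand side does not
  involve \<open>a\<close>, so that one integration suffices. Unlike the usual reduction of order, which divides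
  by \<open>\<phi>\<^sup>2\<close>, this works across the zeros of \<open>\<phi>\<close>: only \<open>N > 0\<close> is needed, and this is
  uniqueness for the initial value problem (\<open>energy_pos\<close>).
\<close>

section \<open>Derivatives on a half-line\<close>

lemma has_deriv_fromD:
  assumes "has_deriv_from t0 f f'" "t0 \<le> t"
  shows "(f has_real_derivative f' t) (at t within {t0..})"
  using assms by (simp add: has_deriv_from_def)

lemma has_deriv_from_continuous_on:
  assumes "has_deriv_from t0 f f'"
  shows "continuous_on {t0..} f"
  using assms unfolding has_deriv_from_def
  by (meson DERIV_continuous_on atLeast_iff)

lemma has_deriv_from_unique:
  assumes "has_deriv_from t0 f g" "has_deriv_from t0 f h" "t0 \<le> t"
  shows "g t = h t"
proof -
  have "at_right t \<le> at t within {t0..}"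
    using assms(3) by (intro at_le) auto
  then have "at t within {t0..} \<noteq> bot"
    using trivial_limit_at_right_real[of t] by (auto simp: bot_unique)
  then show ?thesis
    using has_deriv_fromD[OF assms(1,3)] has_deriv_fromD[OF assms(2,3)]
    by (rule has_field_derivative_unique[rotated 2])
qed

lemma continuous_antiderivative_from:
  assumes "continuous_on {t0..} g"
  shows "has_deriv_from t0 (\<lambda>x. integral {t0..x} g) g"
  unfolding has_deriv_from_def
proof (intro allI impI)
  fix t assume "t0 \<le> t"
  have "continuous_on {t0..t+1} g"
    using assms by (rule continuous_on_subset) auto
  then have "((\<lambda>x. integral {t0..x} g) has_real_derivative g t) (at t within {t0..t+1})"
    using \<open>t0 \<le> t\<close> by (intro integral_has_real_derivative) auto
  moreover have "at t within {t0..t+1} = at t within {t0..}"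
    by (rule at_within_nhd[of _ "{..<t+1}"]) auto
  ultimately show "((\<lambda>x. integral {t0..x} g) has_real_derivative g t) (at t within {t0..})"
    by simp
qed

lemma mean_value_from:
  assumes "has_deriv_from t0 f f'" "t0 \<le> a" "a < b"
  obtains z where "a < z" "z < b" "f b - f a = (b - a) * f' z"
proof -
  have "\<exists>z\<in>{a<..<b}. f b - f a = (\<lambda>h. f' z * h) (b - a)"
  proof (rule mvt_simple[OF \<open>a < b\<close>, where f' = "\<lambda>x h. f' x * h"])
    fix x assume "a \<le> x" "x \<le> b"
    then have "(f has_real_derivative f' x) (at x within {a..b})"
      using assms by (intro DERIV_subset[OF has_deriv_fromD[OF assms(1)]]) auto
    then show "(f has_derivative (\<lambda>h. f' x * h)) (at x within {a..b})"
      by (simp add: has_field_derivative_def)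
  qed
  then show ?thesis using that by (auto simp: mult.commute)
qed

lemma nonneg_deriv_from_mono:
  assumes "has_deriv_from t0 f f'" "t0 \<le> a" "a \<le> b" "\<And>x. a \<le> x \<Longrightarrow> x \<le> b \<Longrightarrow> 0 \<le> f' x"
  shows "f a \<le> f b"
proof (cases "a = b")
  case False
  with assms obtain z where "a < z" "z < b" "f b - f a = (b - a) * f' z"
    by (metis mean_value_from order_less_le)
  moreover from this have "0 \<le> (b - a) * f' z"
    using assms by (intro mult_nonneg_nonneg) auto
  ultimately show ?thesis by linarith
qed simp

section \<open>Nontrivial solutions and their derivatives have no common zero\<close>

text \<open>
  Gronwall's argument in both time directions: \<open>F * exp (K t)\<close> increases and \<open>F * exp (-K t)\<close>
  decreases, so a zero of \<open>F\<close> spreads to the left and to the right.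
\<close>

lemma gronwall_zero:
  assumes F: "has_deriv_from t0 F F'" and nonneg: "\<And>t. t0 \<le> t \<Longrightarrow> 0 \<le> F t"
    and bound: "\<And>t. t0 \<le> t \<Longrightarrow> t \<le> b \<Longrightarrow> \<bar>F' t\<bar> \<le> K * F t"
    and s: "t0 \<le> s" "s \<le> b" "F s = 0" and u: "t0 \<le> u" "u \<le> b"
  shows "F u = 0"
proof -
  have exp_deriv: "has_deriv_from t0 (\<lambda>t. F t * exp (c * t)) (\<lambda>t. (F' t + c * F t) * exp (c * t))"
    for c
    using F unfolding has_deriv_from_def
    by (auto intro!: derivative_eq_intros simp: algebra_simps)
  have "F u \<le> 0"
  proof (cases "u \<le> s")
    case True
    have "F u * exp (K * u) \<le> F s * exp (K * s)"
    proof (rule nonneg_deriv_from_mono[OF exp_deriv])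
      fix x assume "u \<le> x" "x \<le> s"
      then show "0 \<le> (F' x + K * F x) * exp (K * x)"
        using bound[of x] s u by (intro mult_nonneg_nonneg) auto
    qed (use True u in auto)
    then show ?thesis using s by (simp add: mult_le_0_iff)
  next
    case False
    have minus_deriv: "has_deriv_from t0 (\<lambda>t. - (F t * exp (- K * t)))
        (\<lambda>t. - ((F' t + - K * F t) * exp (- K * t)))"
      using exp_deriv[of "- K"] unfolding has_deriv_from_def
      by (auto intro!: DERIV_minus)
    have "- (F s * exp (- K * s)) \<le> - (F u * exp (- K * u))"
    proof (rule nonneg_deriv_from_mono[OF minus_deriv])
      fix x assume "s \<le> x" "x \<le> u"
      then have "(F' x + - K * F x) * exp (- K * x) \<le> 0"
        using bound[of x] s u by (intro mult_nonpos_nonneg) auto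
      then show "0 \<le> - ((F' x + - K * F x) * exp (- K * x))" by linarith
    qed (use False s in auto)
    then show ?thesis using s by (simp add: mult_le_0_iff)
  qed
  with nonneg[OF u(1)] show ?thesis by linarith
qed

lemma energy_deriv:
  fixes f p r :: "real \<Rightarrow> real"
  assumes "has_deriv_from t0 f p" "has_deriv_from t0 p (\<lambda>t. - r t * f t)"
  shows "has_deriv_from t0 (\<lambda>t. (f t)\<^sup>2 + (p t)\<^sup>2) (\<lambda>t. 2 * (1 - r t) * f t * p t)"
  using assms unfolding has_deriv_from_def
  by (auto intro!: derivative_eq_intros simp: algebra_simps)

lemma energy_pos:
  fixes f p r :: "real \<Rightarrow> real"
  assumes r: "continuous_on {t0..} r"
    and f: "has_deriv_from t0 f p" and p: "has_deriv_from t0 p (\<lambda>t. - r t * f t)"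
    and "t0 \<le> u" "f u \<noteq> 0" "t0 \<le> t"
  shows "0 < (f t)\<^sup>2 + (p t)\<^sup>2"
proof (rule ccontr)
  assume "\<not> ?thesis"
  then have zero: "(f t)\<^sup>2 + (p t)\<^sup>2 = 0"
    by (intro antisym) auto
  define b where "b = max t u"
  have "compact ((\<lambda>t. 1 - r t) ` {t0..b})"
    by (intro compact_continuous_image continuous_intros continuous_on_subset[OF r]) auto
  then obtain K where K: "\<And>x. t0 \<le> x \<Longrightarrow> x \<le> b \<Longrightarrow> \<bar>1 - r x\<bar> \<le> K"
    by (force dest!: compact_imp_bounded simp: bounded_iff)
  have "(f u)\<^sup>2 + (p u)\<^sup>2 = 0"
  proof (rule gronwall_zero[OF energy_deriv[OF f p], where K = K and b = b and s = t])
    fix x assume "t0 \<le> x" "x \<le> b"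
    have "0 \<le> (\<bar>f x\<bar> - \<bar>p x\<bar>)\<^sup>2" by simp
    then have "2 * (\<bar>f x\<bar> * \<bar>p x\<bar>) \<le> (f x)\<^sup>2 + (p x)\<^sup>2"
      by (simp add: power2_diff)
    then have "\<bar>1 - r x\<bar> * (2 * (\<bar>f x\<bar> * \<bar>p x\<bar>)) \<le> K * ((f x)\<^sup>2 + (p x)\<^sup>2)"
      using K[OF \<open>t0 \<le> x\<close> \<open>x \<le> b\<close>] by (intro mult_mono) auto
    then show "\<bar>2 * (1 - r x) * f x * p x\<bar> \<le> K * ((f x)\<^sup>2 + (p x)\<^sup>2)"
      by (simp only: abs_mult abs_numeral mult_ac)
  qed (use zero assms in \<open>auto simp: b_def\<close>)
  with \<open>f u \<noteq> 0\<close> show False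
    by (simp add: add_nonneg_eq_0_iff)
qed

section \<open>A second solution\<close>

text \<open>
  In the moving orthogonal frame \<open>(f, p)\<close>, \<open>(-p, f)\<close> the second solution has the coefficient
  \<open>1 / N\<close> along \<open>(-p, f)\<close>, which normalises the Wronskian, and a coefficient \<open>a\<close> along \<open>(f, p)\<close>
  that the equation determines up to a constant by a plain integral.
\<close>

lemma second_solution:
  fixes f p r :: "real \<Rightarrow> real"
  assumes r: "continuous_on {t0..} r"
    and f: "has_deriv_from t0 f p" and p: "has_deriv_from t0 p (\<lambda>t. - r t * f t)"
    and nontrivial: "t0 \<le> u" "f u \<noteq> 0"
  obtains g q where "has_deriv_from t0 g q" "has_deriv_from t0 q (\<lambda>t. - r t * g t)"
    and "\<And>t. t0 \<le> t \<Longrightarrow> f t * q t - p t * g t = 1"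
proof -
  define N where "N t = (f t)\<^sup>2 + (p t)\<^sup>2" for t
  have N_pos: "0 < N t" if "t0 \<le> t" for t
    unfolding N_def using energy_pos[OF r f p nontrivial that] .
  have N: "has_deriv_from t0 N (\<lambda>t. 2 * (1 - r t) * f t * p t)"
    using energy_deriv[OF f p] by (simp add: N_def[abs_def])
  define a' where "a' t = (1 - r t) * ((f t)\<^sup>2 - (p t)\<^sup>2) / (N t)\<^sup>2" for t
  have "continuous_on {t0..} a'"
    unfolding a'_def
    by (intro continuous_intros r has_deriv_from_continuous_on[OF f]
        has_deriv_from_continuous_on[OF p] has_deriv_from_continuous_on[OF N])
      (use N_pos in force)
  then obtain a where a: "has_deriv_from t0 a a'"
    using continuous_antiderivative_from by blast
  define g where "g t = a t * f t - p t / N t" for t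
  define q where "q t = a t * p t + f t / N t" for t
  have g_q: "has_deriv_from t0 g q"
    unfolding has_deriv_from_def
  proof (intro allI impI)
    fix t assume t: "t0 \<le> t"
    note D = has_deriv_fromD[OF f t] has_deriv_fromD[OF p t] has_deriv_fromD[OF N t]
      has_deriv_fromD[OF a t]
    have nz: "N t \<noteq> 0" using N_pos[OF t] by simp
    have "(g has_real_derivative a t * p t + (a' t * f t
        + (r t * f t * N t + p t * (2 * (1 - r t) * f t * p t)) / (N t)\<^sup>2)) (at t within {t0..})"
      unfolding g_def
      by (rule derivative_eq_intros D nz refl)+
        (use nz in \<open>simp add: field_simps power2_eq_square\<close>)
    moreover have "a' t * f t + (r t * f t * N t + p t * (2 * (1 - r t) * f t * p t)) / (N t)\<^sup>2
        = f t / N t"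
    proof -
      have "(1 - r t) * ((f t)\<^sup>2 - (p t)\<^sup>2) * f t
          + (r t * f t * N t + p t * (2 * (1 - r t) * f t * p t)) = f t * N t"
        by (simp add: N_def algebra_simps power2_eq_square)
      then show ?thesis using nz
        by (simp add: a'_def add_divide_distrib[symmetric] power2_eq_square)
    qed
    ultimately show "(g has_real_derivative q t) (at t within {t0..})"
      by (simp only: q_def)
  qed
  have q_rg: "has_deriv_from t0 q (\<lambda>t. - r t * g t)"
    unfolding has_deriv_from_def
  proof (intro allI impI)
    fix t assume t: "t0 \<le> t"
    note D = has_deriv_fromD[OF f t] has_deriv_fromD[OF p t] has_deriv_fromD[OF N t]
      has_deriv_fromD[OF a t]
    have nz: "N t \<noteq> 0" using N_pos[OF t] by simp
    have "(q has_real_derivative - r t * a t * f t + (a' t * p t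
        + (p t * N t - f t * (2 * (1 - r t) * f t * p t)) / (N t)\<^sup>2)) (at t within {t0..})"
      unfolding q_def
      by (rule derivative_eq_intros D nz refl)+
        (use nz in \<open>simp add: field_simps power2_eq_square\<close>)
    moreover have "a' t * p t + (p t * N t - f t * (2 * (1 - r t) * f t * p t)) / (N t)\<^sup>2
        = r t * p t / N t"
    proof -
      have "(1 - r t) * ((f t)\<^sup>2 - (p t)\<^sup>2) * p t
          + (p t * N t - f t * (2 * (1 - r t) * f t * p t)) = r t * p t * N t"
        by (simp add: N_def algebra_simps power2_eq_square)
      then show ?thesis using nz
        by (simp add: a'_def add_divide_distrib[symmetric] power2_eq_square)
    qed
    ultimately have
      "(q has_real_derivative - r t * a t * f t + r t * p t / N t) (at t within {t0..})"
      by (simp only:)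
    then show "(q has_real_derivative - r t * g t) (at t within {t0..})"
      by (simp add: g_def algebra_simps)
  qed
  have "f t * q t - p t * g t = 1" if "t0 \<le> t" for t
  proof -
    have "f t * q t - p t * g t = ((f t)\<^sup>2 + (p t)\<^sup>2) / N t"
      by (simp add: q_def g_def algebra_simps add_divide_distrib power2_eq_square)
    then show ?thesis using N_pos[OF that] by (simp flip: N_def)
  qed
  with g_q q_rg show ?thesis by (rule that)
qed

section \<open>Unboundedness of the derivative\<close>

theorem mainTheorem3:
  fixes r :: "real \<Rightarrow> real" and t0 :: real
  assumes "continuous_on {t0..} r"
    and "\<And>\<phi>. is_solution t0 r \<phi> \<Longrightarrow> (\<phi> \<longlongrightarrow> 0) at_top"
  shows "\<forall>\<phi> \<phi>'. is_solution t0 r \<phi> \<and> (\<exists>t\<ge>t0. \<phi> t \<noteq> 0) \<and> has_deriv_from t0 \<phi> \<phi>'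
           \<longrightarrow> \<not> bounded (\<phi>' ` {t0..})"
proof (intro allI impI notI)
  fix \<phi> \<phi>'
  assume "is_solution t0 r \<phi> \<and> (\<exists>t\<ge>t0. \<phi> t \<noteq> 0) \<and> has_deriv_from t0 \<phi> \<phi>'"
  then obtain u where sol: "is_solution t0 r \<phi>" and u: "t0 \<le> u" "\<phi> u \<noteq> 0"
    and \<phi>': "has_deriv_from t0 \<phi> \<phi>'"
    by blast
  assume "bounded (\<phi>' ` {t0..})"
  then obtain B where B: "0 < B" "\<And>t. t0 \<le> t \<Longrightarrow> \<bar>\<phi>' t\<bar> \<le> B"
    by (force simp: bounded_pos)
  obtain p s where p: "has_deriv_from t0 \<phi> p" and s: "has_deriv_from t0 p s"
    and eq: "\<And>t. t0 \<le> t \<Longrightarrow> s t + r t * \<phi> t = 0"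
    using sol unfolding is_solution_def by blast
  have "s t = - r t * \<phi> t" if "t0 \<le> t" for t
    using eq[OF that] by simp
  with s have "has_deriv_from t0 p (\<lambda>t. - r t * \<phi> t)"
    by (simp add: has_deriv_from_def)
  then obtain \<psi> \<psi>' where \<psi>: "has_deriv_from t0 \<psi> \<psi>'" "has_deriv_from t0 \<psi>' (\<lambda>t. - r t * \<psi> t)"
    and W: "\<And>t. t0 \<le> t \<Longrightarrow> \<phi> t * \<psi>' t - p t * \<psi> t = 1"
    using second_solution[OF assms(1) p _ u] by blast
  then have wronskian: "\<phi> t * \<psi>' t - \<phi>' t * \<psi> t = 1" if "t0 \<le> t" for t
    using W[OF that] has_deriv_from_unique[OF p \<phi>' that] by simp
  have "is_solution t0 r \<psi>"
    unfolding is_solution_def using \<psi> by fastforce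
  then have \<psi>_lim: "(\<psi> \<longlongrightarrow> 0) at_top" and \<phi>_lim: "(\<phi> \<longlongrightarrow> 0) at_top"
    using assms(2) sol by blast+
  have "\<forall>\<^sub>F t in at_top. t0 \<le> t \<and> \<bar>\<psi> t\<bar> < 1/2 \<and> \<bar>\<psi> t\<bar> < 1 / (2 * B) \<and> \<bar>\<phi> t\<bar> < 1/2"
    using tendstoD[OF \<psi>_lim, of "1/2"] tendstoD[OF \<psi>_lim, of "1 / (2 * B)"]
      tendstoD[OF \<phi>_lim, of "1/2"] B(1)
    by (intro eventually_conj eventually_ge_at_top) (auto simp: dist_real_def)
  then obtain T where "\<And>t. T \<le> t \<Longrightarrow>
      t0 \<le> t \<and> \<bar>\<psi> t\<bar> < 1/2 \<and> \<bar>\<psi> t\<bar> < 1 / (2 * B) \<and> \<bar>\<phi> t\<bar> < 1/2"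
    by (auto simp: eventually_at_top_linorder)
  then have T: "t0 \<le> t" "\<bar>\<psi> t\<bar> < 1/2" "\<bar>\<psi> t\<bar> < 1 / (2 * B)" "\<bar>\<phi> t\<bar> < 1/2" if "T \<le> t" for t
    using that by blast+
  have steep: "1 < \<bar>\<psi>' t\<bar>" if "T \<le> t" for t
  proof (rule ccontr)
    assume "\<not> ?thesis"
    then have "\<bar>\<phi> t * \<psi>' t\<bar> \<le> 1/2 * 1"
      unfolding abs_mult using T(4)[OF that] by (intro mult_mono) auto
    moreover have "\<bar>\<phi>' t * \<psi> t\<bar> < 1/2"
    proof -
      have "\<bar>\<phi>' t\<bar> * \<bar>\<psi> t\<bar> \<le> B * \<bar>\<psi> t\<bar>"
        using B(2)[OF T(1)[OF that]] by (intro mult_right_mono) auto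
      also have "\<dots> < B * (1 / (2 * B))"
        using T(3)[OF that] B(1) by (intro mult_strict_left_mono)
      also have "\<dots> = 1/2" using B(1) by simp
      finally show ?thesis by (simp add: abs_mult)
    qed
    ultimately show False
      using wronskian[OF T(1)[OF that]] by linarith
  qed
  obtain z where "T < z" "\<psi> (T + 1) - \<psi> T = (T + 1 - T) * \<psi>' z"
    using mean_value_from[OF \<psi>(1) T(1)[OF order_refl], of "T + 1"] by auto
  then show False
    using steep[of z] T(2)[of T] T(2)[of "T + 1"] by simp
qed

end
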